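(* Let $X$ be a complex Hilbert space and let $T\in B(X)$ be polynomially bounded. Then $T$ is null-orbit reflexive and $T$ is orbit reflexive.
   Context: $B(X)$ is the set of bounded linear operators on $X$. $T$ is polynomially bounded if there is a constant $K$ such that $\|p(T)\|\le K\sup_{|z|\le 1}|p(z)|$ for every complex polynomial $p$. $\mathrm{Orb}(T)=\{1,T,T^2,\ldots\}$ and $\mathrm{nullOrb}(T)=\{0,1,T,T^2,\ldots\}$, where $1$ is the identity. For a set $\mathcal S$ of operators, $\mathcal S x=\{Ax: A\in\mathcal S\}$, and $E^-$ denotes the norm closure of a set $E$ of vectors. $\mathrm{OrbRef}(T)$ is the set of all $S\in B(X)$ such that $Sx\in[\mathrm{Orb}(T)x]^-$ for every $x\in X$; $T$ is orbit reflexive if $\mathrm{OrbRef}(T)$ equals the strong-operator-topology closure of $\mathrm{Orb}(T)$. $\mathrm{nullOrbRef}(T)$ is the set of all $S\in B(X)$ such that $Sx\in[\mathrm{nullOrb}(T)x]^-$ for every $x\in X$; $T$ is null-orbit reflexive if $\mathrm{nullOrbRef}(T)$ equals the strong-operator-topology closure of $\mathrm{nullOrb}(T)$. *)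

theory Defs
  imports "HOL-Analysis.Analysis" "HOL-Computational_Algebra.Polynomial"
begin

section \<open>Complex Hilbert spaces\<close>

class complex_vector_space = real_vector +
  fixes scaleC :: "complex \<Rightarrow> 'a \<Rightarrow> 'a" (infixr "*\<^sub>C" 75)
  assumes scaleC_add_right: "c *\<^sub>C (x + y) = c *\<^sub>C x + c *\<^sub>C y"
    and scaleC_add_left: "(b + c) *\<^sub>C x = b *\<^sub>C x + c *\<^sub>C x"
    and scaleC_scaleC: "b *\<^sub>C c *\<^sub>C x = (b * c) *\<^sub>C x"
    and scaleC_of_real: "of_real r *\<^sub>C x = r *\<^sub>R x"

text \<open>
  The complex inner product is linear in the first argument. Its real part is required to be the
  real inner product of the class \<^class>\<open>real_inner\<close>; together with conjugate symmetry this
  makes \<open>cinner x x\<close> a nonnegative real, vanishing only for \<open>x = 0\<close>, and it makes the norm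
  the one induced by \<open>cinner\<close> (see \<open>cinner_self\<close> and \<open>norm_eq_sqrt_cinner\<close> below).
\<close>

class complex_inner_space = complex_vector_space + real_inner +
  fixes cinner :: "'a \<Rightarrow> 'a \<Rightarrow> complex"
  assumes cinner_commute: "cinner x y = cnj (cinner y x)"
    and cinner_add_left: "cinner (x + y) z = cinner x z + cinner y z"
    and cinner_scaleC_left: "cinner (c *\<^sub>C x) y = c * cinner x y"
    and inner_eq_Re_cinner: "inner x y = Re (cinner x y)"

class complex_hilbert_space = complex_inner_space + complete_space

lemma scaleC_one [simp]: "1 *\<^sub>C x = (x :: 'a::complex_vector_space)"
  using scaleC_of_real[of 1 x] by simp

lemma cinner_self: "cinner x x = of_real (inner x x)"
  for x :: "'a::complex_inner_space"
  by (metis Reals_cnj_iff cinner_commute inner_eq_Re_cinner of_real_Re)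

lemma norm_eq_sqrt_cinner: "norm x = sqrt (Re (cinner x x))"
  for x :: "'a::complex_inner_space"
  by (simp add: norm_eq_sqrt_inner inner_eq_Re_cinner)

lemma cinner_scaleC_right: "cinner x (c *\<^sub>C y) = cnj c * cinner x y"
  for x y :: "'a::complex_inner_space"
  by (metis cinner_commute cinner_scaleC_left complex_cnj_mult)

lemma norm_scaleC: "norm (c *\<^sub>C x) = cmod c * norm x"
  for x :: "'a::complex_inner_space"
proof -
  have "cinner (c *\<^sub>C x) (c *\<^sub>C x) = (c * cnj c) * cinner x x"
    by (simp add: cinner_scaleC_left cinner_scaleC_right mult.assoc)
  also have "\<dots> = of_real ((cmod c)\<^sup>2 * inner x x)"
    by (simp only: cinner_self complex_norm_square of_real_mult)
  finally have "inner (c *\<^sub>C x) (c *\<^sub>C x) = (cmod c)\<^sup>2 * inner x x"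
    by (simp only: cinner_self of_real_eq_iff)
  then show ?thesis
    by (simp add: norm_eq_sqrt_inner real_sqrt_mult)
qed

lemma bounded_linear_scaleC: "bounded_linear (\<lambda>x :: 'a::complex_inner_space. c *\<^sub>C x)"
proof (rule bounded_linear_intro[where K = "cmod c"])
  show "c *\<^sub>C (r *\<^sub>R x) = r *\<^sub>R (c *\<^sub>C x)" for r and x :: 'a
    by (simp only: scaleC_of_real[symmetric] scaleC_scaleC mult.commute)
qed (simp_all add: scaleC_add_right norm_scaleC mult.commute)

instantiation complex :: complex_hilbert_space
begin

definition scaleC_complex :: "complex \<Rightarrow> complex \<Rightarrow> complex"
  where "scaleC_complex c x = c * x"

definition cinner_complex :: "complex \<Rightarrow> complex \<Rightarrow> complex"
  where "cinner_complex x y = x * cnj y"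

instance
  by standard
    (simp_all add: scaleC_complex_def cinner_complex_def algebra_simps scaleR_conv_of_real
      inner_complex_def)

end

section \<open>Operators\<close>

text \<open>
  The type \<^typ>\<open>'a \<Rightarrow>\<^sub>L 'a\<close> consists of the bounded real-linear operators, so \<open>B(X)\<close> is its subset
  of complex-linear ones. The norm of this type is the operator norm.
\<close>

definition bounded_ops :: "('a::complex_hilbert_space \<Rightarrow>\<^sub>L 'a) set"
  where "bounded_ops = {A. \<forall>c x. blinfun_apply A (c *\<^sub>C x) = c *\<^sub>C blinfun_apply A x}"

definition op_power :: "('a::complex_hilbert_space \<Rightarrow>\<^sub>L 'a) \<Rightarrow> nat \<Rightarrow> ('a \<Rightarrow>\<^sub>L 'a)"
  where "op_power T n = ((\<lambda>A. T o\<^sub>L A) ^^ n) id_blinfun"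

lift_definition op_scaleC :: "complex \<Rightarrow> ('a::complex_hilbert_space \<Rightarrow>\<^sub>L 'a) \<Rightarrow> ('a \<Rightarrow>\<^sub>L 'a)"
  is "\<lambda>c A x. c *\<^sub>C A x"
  by (rule bounded_linear_compose[OF bounded_linear_scaleC])

definition op_poly :: "complex poly \<Rightarrow> ('a::complex_hilbert_space \<Rightarrow>\<^sub>L 'a) \<Rightarrow> ('a \<Rightarrow>\<^sub>L 'a)"
  where "op_poly p T = (\<Sum>i\<le>degree p. op_scaleC (coeff p i) (op_power T i))"

definition polynomially_bounded :: "('a::complex_hilbert_space \<Rightarrow>\<^sub>L 'a) \<Rightarrow> bool"
  where "polynomially_bounded T \<longleftrightarrow>
    (\<exists>K::real. \<forall>p::complex poly.
      norm (op_poly p T) \<le> K * (SUP z\<in>{z. cmod z \<le> 1}. cmod (poly p z)))"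

section \<open>Orbit reflexivity\<close>

definition sot :: "('a::complex_hilbert_space \<Rightarrow>\<^sub>L 'a) topology"
  where "sot = subtopology strong_operator_topology bounded_ops"

definition Orb :: "('a::complex_hilbert_space \<Rightarrow>\<^sub>L 'a) \<Rightarrow> ('a \<Rightarrow>\<^sub>L 'a) set"
  where "Orb T = range (op_power T)"

definition nullOrb :: "('a::complex_hilbert_space \<Rightarrow>\<^sub>L 'a) \<Rightarrow> ('a \<Rightarrow>\<^sub>L 'a) set"
  where "nullOrb T = insert 0 (Orb T)"

definition ops_at :: "('a::complex_hilbert_space \<Rightarrow>\<^sub>L 'a) set \<Rightarrow> 'a \<Rightarrow> 'a set"
  where "ops_at \<S> x = (\<lambda>A. blinfun_apply A x) ` \<S>"

lemma op_power_in_bounded_ops: "T \<in> bounded_ops \<Longrightarrow> op_power T n \<in> bounded_ops"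
  by (induction n) (auto simp: op_power_def bounded_ops_def)

lemma nullOrb_subset_bounded_ops:
  assumes "T \<in> bounded_ops"
  shows "nullOrb T \<subseteq> bounded_ops"
proof -
  have "c *\<^sub>C (0::'a) = 0" for c
    using scaleC_add_right[of c "0::'a" 0] by simp
  then show ?thesis
    using op_power_in_bounded_ops[OF assms]
    by (auto simp: nullOrb_def Orb_def) (simp add: bounded_ops_def)
qed

definition OrbRef :: "('a::complex_hilbert_space \<Rightarrow>\<^sub>L 'a) \<Rightarrow> ('a \<Rightarrow>\<^sub>L 'a) set"
  where "OrbRef T = {S \<in> bounded_ops. \<forall>x. blinfun_apply S x \<in> closure (ops_at (Orb T) x)}"

definition nullOrbRef :: "('a::complex_hilbert_space \<Rightarrow>\<^sub>L 'a) \<Rightarrow> ('a \<Rightarrow>\<^sub>L 'a) set"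
  where "nullOrbRef T = {S \<in> bounded_ops. \<forall>x. blinfun_apply S x \<in> closure (ops_at (nullOrb T) x)}"

definition orbit_reflexive :: "('a::complex_hilbert_space \<Rightarrow>\<^sub>L 'a) \<Rightarrow> bool"
  where "orbit_reflexive T \<longleftrightarrow> OrbRef T = sot closure_of Orb T"

definition null_orbit_reflexive :: "('a::complex_hilbert_space \<Rightarrow>\<^sub>L 'a) \<Rightarrow> bool"
  where "null_orbit_reflexive T \<longleftrightarrow> nullOrbRef T = sot closure_of nullOrb T"

end

theory Submission
  imports Defs
begin

text \<open>
  Polynomial boundedness, applied to \<open>z\<^sup>n\<close>, gives \<open>\<parallel>T\<^sup>n\<parallel> \<le> M\<close>. Let \<open>S\<close> be in \<open>nullOrbRef T\<close>, different
  from \<open>0\<close> and from every power of \<open>T\<close>. By Baire's theorem every \<open>S x\<close> is a limit of vectors \<open>T\<^sup>n x\<close>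
  with \<open>n \<rightarrow> \<infinity>\<close>. A Banach limit of \<open>\<langle>T\<^sup>n x, T\<^sup>n y\<rangle>\<close> is a semi-inner product \<open>\<beta>\<close> for which \<open>T\<close> and \<open>S\<close>
  are isometric; its seminorm \<open>q\<close> is equivalent to \<open>limsup \<parallel>T\<^sup>n x\<parallel>\<close>. Polarization gives
  \<open>q (T S x - S T x) = 0\<close>, and since recurrent vectors are determined modulo the kernel of \<open>q\<close>, the
  operators commute.

  The point is to approximate on several vectors with a single power. Put \<open>D n = T\<^sup>n - S\<close> and, for two
  vectors \<open>x, y\<close>, choose exponents \<open>r i\<close> such that \<open>D (r i) (x + i y)\<close> is small for \<open>i < N\<close>.
  Spectrally, at each point at most one of the combinations \<open>x + i y\<close> is degenerate, so the sets where
  the \<open>D (r i)\<close> are large are nearly disjoint and one \<open>D (r i)\<close> must be small on both \<open>x\<close> and \<open>y\<close>.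
  Finally, \<open>\<parallel>S x\<parallel> \<le> M q x\<close> turns approximation in \<open>q\<close> into approximation in norm.
\<close>

section \<open>Banach limits\<close>

text \<open>\<open>L\<close> is a cluster point of the averaging functionals in a product of compact
  intervals, one factor per sequence. Linearity and positivity survive the limit; shift invariance
  appears because the averages of \<open>f\<close> and of its shift differ by a telescoped term of
  order 1/N.\<close>

lemma banach_limit_exists:
  obtains L :: "(nat \<Rightarrow> real) \<Rightarrow> real" where
    "\<And>f g. Bseq f \<Longrightarrow> Bseq g \<Longrightarrow> L (\<lambda>n. f n + g n) = L f + L g"
    "\<And>c f. Bseq f \<Longrightarrow> L (\<lambda>n. c * f n) = c * L f"
    "\<And>f. Bseq f \<Longrightarrow> L (\<lambda>n. f (Suc n)) = L f"
    "\<And>c f. Bseq f \<Longrightarrow> (\<And>n. c \<le> f n) \<Longrightarrow> c \<le> L f"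
proof -
  \<comment> \<open>The value 0 on unbounded sequences keeps \<open>avg N f\<close> within
    \<open>B f\<close> for every \<open>f\<close>, so all averages lie in one compact
    product.\<close>
  define avg :: "nat \<Rightarrow> (nat \<Rightarrow> real) \<Rightarrow> real"
    where "avg N f = (if Bseq f then (\<Sum>n\<le>N. f n) / real (Suc N) else 0)" for N f
  define B :: "(nat \<Rightarrow> real) \<Rightarrow> real"
    where "B f = (SOME b. 0 \<le> b \<and> (Bseq f \<longrightarrow> (\<forall>n. \<bar>f n\<bar> \<le> b)))" for f
  have B: "0 \<le> B f" "Bseq f \<Longrightarrow> \<bar>f n\<bar> \<le> B f" for f n
  proof -
    have "\<exists>b. 0 \<le> b \<and> (Bseq f \<longrightarrow> (\<forall>n. \<bar>f n\<bar> \<le> b))"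
      by (metis BseqE less_imp_le order_refl real_norm_def)
    then have "0 \<le> B f \<and> (Bseq f \<longrightarrow> (\<forall>n. \<bar>f n\<bar> \<le> B f))"
      unfolding B_def by (rule someI_ex)
    then show "0 \<le> B f" "Bseq f \<Longrightarrow> \<bar>f n\<bar> \<le> B f" by auto
  qed
  have avg_lower: "c \<le> avg N f" if "Bseq f" "\<And>n. c \<le> f n" for c f N
  proof -
    have "real (Suc N) * c \<le> (\<Sum>n\<le>N. f n)"
      using sum_bounded_below[of "{..N}" c f] that by simp
    then show ?thesis using that(1) by (simp add: avg_def field_simps)
  qed
  have avg_abs: "\<bar>avg N f\<bar> \<le> B f" for N f
  proof (cases "Bseq f")
    case True
    have "\<bar>\<Sum>n\<le>N. f n\<bar> \<le> real (Suc N) * B f"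
      using sum_norm_bound[of "{..N}" f "B f"] B(2)[OF True] by simp
    then show ?thesis using True by (simp add: avg_def field_simps abs_divide)
  qed (simp add: avg_def B)
  let ?K = "PiE UNIV (\<lambda>f. {- B f .. B f})"
  have "compact ?K"
    using compactin_PiE[of "\<lambda>_. euclidean :: real topology" UNIV "\<lambda>f. {- B f .. B f}"]
    by (simp add: euclidean_product_topology)
  moreover have "eventually (\<lambda>l. l \<in> ?K) (filtermap avg sequentially)"
    using avg_abs by (simp add: eventually_filtermap PiE_iff abs_le_iff minus_le_iff)
  moreover have "filtermap avg sequentially \<noteq> bot"
    by (simp add: filtermap_bot_iff)
  \<comment> \<open>Compactness yields only a cluster point, so limits are taken along the
    nontrivial filter \<open>?F\<close> instead of along the averages themselves.\<close>
  ultimately obtain L where L: "inf (nhds L) (filtermap avg sequentially) \<noteq> bot"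
    unfolding compact_filter by blast
  let ?F = "inf (nhds L) (filtermap avg sequentially)"
  have lim: "((\<lambda>l. l f) \<longlongrightarrow> L f) ?F" for f
  proof -
    have "((\<lambda>l. l f) \<longlongrightarrow> L f) (nhds L)"
    proof (rule topological_tendstoI)
      fix A assume "open A" "L f \<in> A"
      moreover have "open ((\<lambda>l. l f) -` A)"
        using \<open>open A\<close> by (rule open_vimage) simp
      ultimately show "\<forall>\<^sub>F l in nhds L. l f \<in> A"
        unfolding eventually_nhds by (intro exI[of _ "(\<lambda>l. l f) -` A"]) auto
    qed
    then show ?thesis by (rule tendsto_mono[rotated]) simp
  qed
  have ev: "eventually P ?F" if "\<And>N. P (avg N)" for P
  proof -
    have "eventually P (filtermap avg sequentially)"
      using that by (simp add: eventually_filtermap)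
    then show ?thesis by (rule filter_leD[rotated]) simp
  qed
  have eqI: "u = v" if "(p \<longlongrightarrow> u) ?F" "(p' \<longlongrightarrow> v) ?F" "\<And>N. p (avg N) = p' (avg N)" for u v :: real and p p'
  proof -
    have "(p' \<longlongrightarrow> u) ?F" using that by (subst tendsto_cong[symmetric, OF ev]) auto
    with that(2) L show ?thesis using tendsto_unique by blast
  qed
  show ?thesis
  proof
    fix f g :: "nat \<Rightarrow> real" assume f: "Bseq f" and g: "Bseq g"
    have "Bseq (\<lambda>n. f n + g n)"
      by (rule BseqI'[of _ "B f + B g"]) (use B(2)[OF f] B(2)[OF g] abs_triangle_ineq in \<open>fastforce intro: order_trans add_mono\<close>)
    then show "L (\<lambda>n. f n + g n) = L f + L g"
      using f g
      by (intro eqI[OF lim tendsto_add[OF lim lim]]) (simp add: avg_def sum.distrib add_divide_distrib)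
  next
    fix c :: real and f :: "nat \<Rightarrow> real" assume f: "Bseq f"
    have "Bseq (\<lambda>n. c * f n)"
      by (rule BseqI'[of _ "\<bar>c\<bar> * B f"]) (simp add: abs_mult mult_left_mono B(2)[OF f])
    then show "L (\<lambda>n. c * f n) = c * L f"
      using f
      by (intro eqI[OF lim tendsto_mult_left[OF lim]]) (simp add: avg_def sum_distrib_left[symmetric])
  next
    fix f :: "nat \<Rightarrow> real" assume f: "Bseq f"
    have f': "Bseq (\<lambda>n. f (Suc n))" using f by (simp add: Bseq_Suc_iff)
    have diff: "avg N (\<lambda>n. f (Suc n)) - avg N f = (f (Suc N) - f 0) / real (Suc N)" for N
    proof -
      have "(\<Sum>n\<le>N. f (Suc n)) - (\<Sum>n\<le>N. f n) = f (Suc N) - f 0"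
        by (induction N) auto
      then show ?thesis using f f' by (simp add: avg_def diff_divide_distrib[symmetric])
    qed
    have "(\<lambda>N. avg N (\<lambda>n. f (Suc n)) - avg N f) \<longlonglongrightarrow> 0"
    proof (rule Lim_null_comparison)
      show "(\<lambda>N. 2 * B f / real (Suc N)) \<longlonglongrightarrow> 0"
        using tendsto_mult[OF tendsto_const LIMSEQ_inverse_real_of_nat, of "2 * B f"]
        by (simp add: divide_inverse)
      have "\<bar>f (Suc N) - f 0\<bar> \<le> 2 * B f" for N
        using B(2)[OF f, of "Suc N"] B(2)[OF f, of 0] by linarith
      then show "\<forall>\<^sub>F N in sequentially. norm (avg N (\<lambda>n. f (Suc n)) - avg N f) \<le> 2 * B f / real (Suc N)"
        unfolding diff by (intro always_eventually allI) (simp add: abs_divide divide_right_mono)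
    qed
    then have "((\<lambda>l. l (\<lambda>n. f (Suc n)) - l f) \<longlongrightarrow> 0) (filtermap avg sequentially)"
      by (simp add: filterlim_filtermap)
    then have "((\<lambda>l. l (\<lambda>n. f (Suc n)) - l f) \<longlongrightarrow> 0) ?F"
      by (rule tendsto_mono[rotated]) simp
    from tendsto_unique[OF L this tendsto_diff[OF lim lim]]
    show "L (\<lambda>n. f (Suc n)) = L f" by simp
  next
    fix c :: real and f :: "nat \<Rightarrow> real" assume f: "Bseq f" and "\<And>n. c \<le> f n"
    then show "c \<le> L f"
      using avg_lower[OF f] by (intro tendsto_lowerbound[OF lim ev L]) auto
  qed
qed

section \<open>Commuting isometries of a semi-inner product\<close>

lemma linear_funpow:
  fixes T :: "'a::real_vector \<Rightarrow> 'a"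
  assumes "linear T"
  shows "linear (T ^^ n)"
proof (induction n)
  case (Suc n)
  show ?case using linear_compose[OF Suc.IH assms] by (simp add: o_def)
qed (simp add: linear_id[unfolded id_def])

section \<open>Possibly degenerate inner products and their seminorms\<close>

locale semi_inner =
  fixes \<beta> :: "'a::real_vector \<Rightarrow> 'a \<Rightarrow> real"
  assumes add_left: "\<beta> (x + y) z = \<beta> x z + \<beta> y z"
    and scale_left: "\<beta> (r *\<^sub>R x) z = r * \<beta> x z"
    and sym: "\<beta> x y = \<beta> y x"
    and nonneg: "0 \<le> \<beta> x x"
begin

lemma add_right: "\<beta> x (y + z) = \<beta> x y + \<beta> x z"
  by (metis add_left sym)

lemma scale_right: "\<beta> x (r *\<^sub>R y) = r * \<beta> x y"
  by (metis scale_left sym)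

lemma minus_left: "\<beta> (- x) y = - \<beta> x y"
  using scale_left[of "-1" x y] by simp

lemma minus_right: "\<beta> x (- y) = - \<beta> x y"
  using scale_right[of x "-1" y] by simp

lemma diff_left: "\<beta> (x - y) z = \<beta> x z - \<beta> y z"
  by (metis add_left minus_left add_uminus_conv_diff)

lemma diff_right: "\<beta> x (y - z) = \<beta> x y - \<beta> x z"
  by (metis add_right minus_right add_uminus_conv_diff)

lemma zero_left: "\<beta> 0 y = 0"
  using scale_left[of 0 0 y] by simp

lemma sum_left: "\<beta> (sum f I) y = (\<Sum>i\<in>I. \<beta> (f i) y)"
  by (induction I rule: infinite_finite_induct) (auto simp: zero_left add_left)

lemma sum_right: "\<beta> y (sum f I) = (\<Sum>i\<in>I. \<beta> y (f i))"
  using sum_left sym by simp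

definition q :: "'a \<Rightarrow> real"
  where "q x = sqrt (\<beta> x x)"

lemma q_nonneg: "0 \<le> q x"
  by (simp add: q_def nonneg)

lemma q_square: "(q x)\<^sup>2 = \<beta> x x"
  by (simp add: q_def nonneg)

lemma Cauchy_Schwarz_square: "(\<beta> x y)\<^sup>2 \<le> \<beta> x x * \<beta> y y"
proof -
  have *: "0 \<le> \<beta> x x - 2 * s * \<beta> x y + s\<^sup>2 * \<beta> y y" for s
    using nonneg[of "x - s *\<^sub>R y"]
    by (simp add: diff_left diff_right scale_left scale_right sym[of y x] power2_eq_square algebra_simps)
  show ?thesis
  proof (cases "\<beta> y y = 0")
    case True
    have "\<beta> x y = 0"
    proof (rule ccontr)
      assume "\<beta> x y \<noteq> 0"
      \<comment> \<open>This choice of \<open>s\<close> makes the right side of \<open>*\<close>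
        equal to -1.\<close>
      then show False using *[of "(\<beta> x x + 1) / (2 * \<beta> x y)"] True nonneg[of x] by simp
    qed
    then show ?thesis using True by simp
  next
    case False
    then have "0 < \<beta> y y" using nonneg[of y] by simp
    then show ?thesis
      using *[of "\<beta> x y / \<beta> y y"] by (simp add: power2_eq_square field_simps)
  qed
qed

lemma Cauchy_Schwarz: "\<bar>\<beta> x y\<bar> \<le> q x * q y"
proof -
  have "\<bar>\<beta> x y\<bar>\<^sup>2 \<le> (q x * q y)\<^sup>2"
    using Cauchy_Schwarz_square[of x y] by (simp add: power_mult_distrib q_square)
  then show ?thesis by (rule power2_le_imp_le) (simp add: q_nonneg)
qed

lemma q_triangle: "q (x + y) \<le> q x + q y"
proof (rule power2_le_imp_le)
  have "(q (x + y))\<^sup>2 = (q x)\<^sup>2 + 2 * \<beta> x y + (q y)\<^sup>2"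
    by (simp add: q_square add_left add_right sym[of y x])
  also have "\<dots> \<le> (q x + q y)\<^sup>2"
    using Cauchy_Schwarz[of x y] by (simp add: power2_sum)
  finally show "(q (x + y))\<^sup>2 \<le> (q x + q y)\<^sup>2" .
qed (simp add: q_nonneg)

lemma q_scale: "q (r *\<^sub>R x) = \<bar>r\<bar> * q x"
  by (simp add: q_def scale_left scale_right real_sqrt_mult mult.assoc[symmetric])

lemma q_minus: "q (- x) = q x"
  by (simp add: q_def minus_left minus_right)

lemma q_commute: "q (x - y) = q (y - x)"
  by (metis q_minus minus_diff_eq)

lemma q_diff_le: "q (x - y) \<le> q x + q y"
  using q_triangle[of x "- y"] by (simp add: q_minus)

lemma isometry_polarization:
  assumes "linear A" "\<And>x. q (A x) = q x"
  shows "\<beta> (A x) (A y) = \<beta> x y"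
proof -
  have "\<beta> (A (x + y)) (A (x + y)) = \<beta> (x + y) (x + y)" "\<beta> (A x) (A x) = \<beta> x x"
    "\<beta> (A y) (A y) = \<beta> y y"
    using assms(2) by (metis q_square)+
  then show ?thesis
    by (simp add: linear_add[OF assms(1)] add_left add_right sym[of "A y" "A x"] sym[of y x])
qed

end

section \<open>Commuting isometries and the differences of powers of \<open>T\<close> with
  \<open>S\<close>\<close>

locale isometry_family = semi_inner \<beta> for \<beta> :: "'a::real_vector \<Rightarrow> 'a \<Rightarrow> real" +
  fixes T S :: "'a \<Rightarrow> 'a"
  assumes linear_T: "linear T" and linear_S: "linear S"
    and isometry_T: "\<beta> (T x) (T y) = \<beta> x y"
    and isometry_S: "\<beta> (S x) (S y) = \<beta> x y"
    and commute: "T (S x) = S (T x)"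
begin

lemmas linear_pow = linear_funpow[OF linear_T]
lemmas funpow_simps = linear_add[OF linear_pow] linear_diff[OF linear_pow]
  linear_neg[OF linear_pow] linear_cmul[OF linear_pow]
lemmas S_simps = linear_add[OF linear_S] linear_diff[OF linear_S] linear_neg[OF linear_S] linear_cmul[OF linear_S]

lemma isometry_funpow: "\<beta> ((T ^^ n) x) ((T ^^ n) y) = \<beta> x y"
  by (induction n) (auto simp: isometry_T)

lemma q_funpow: "q ((T ^^ n) x) = q x"
  by (simp add: q_def isometry_funpow)

lemma q_S: "q (S x) = q x"
  by (simp add: q_def isometry_S)

lemma commute_funpow: "(T ^^ n) (S x) = S ((T ^^ n) x)"
  by (induction n) (auto simp: commute)

lemma funpow_commute: "(T ^^ m) ((T ^^ n) x) = (T ^^ n) ((T ^^ m) x)"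
  by (metis add.commute comp_apply funpow_add)

definition D :: "nat \<Rightarrow> 'a \<Rightarrow> 'a"
  where "D n x = (T ^^ n) x - S x"

lemma D_add: "D n (x + y) = D n x + D n y"
  by (simp add: D_def funpow_simps S_simps)

lemma D_diff: "D n (x - y) = D n x - D n y"
  by (simp add: D_def funpow_simps S_simps)

lemma D_neg: "D n (- x) = - D n x"
  by (simp add: D_def funpow_simps S_simps)

lemma D_scale: "D n (r *\<^sub>R x) = r *\<^sub>R D n x"
  by (simp add: D_def funpow_simps S_simps scaleR_diff_right)

lemma D_S: "D n (S x) = S (D n x)"
  by (simp add: D_def S_simps commute_funpow)

lemma D_funpow: "D n ((T ^^ m) x) = (T ^^ m) (D n x)"
  by (simp add: D_def funpow_simps commute_funpow funpow_commute[of m])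

lemma D_commute: "D m (D n x) = D n (D m x)"
  by (simp add: D_def[of n] D_diff D_S D_funpow)

lemma q_D_le: "q (D n x) \<le> 2 * q x"
  using q_diff_le[of "(T ^^ n) x" "S x"] by (simp add: D_def q_funpow q_S)

text \<open>For commuting unitaries \<open>V = T ^^ n\<close> and \<open>S\<close>, the adjoint of
  \<open>V - S\<close> is \<open>- V^-1 S^-1 (V - S)\<close>. Putting \<open>V S\<close> on the
  right-hand argument states this without inverses.\<close>

lemma D_adjoint: "\<beta> (D n x) ((T ^^ n) (S y)) = - \<beta> x (D n y)"
  by (simp add: D_def diff_left diff_right isometry_funpow)
     (simp add: commute_funpow isometry_S)

text \<open>
  The vectors \<open>u i\<close> stand for \<open>D\<^sup>* D h\<close> with \<open>D = D (r i)\<close>. For commuting unitaries \<open>V = T ^^ r i\<close> and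
  \<open>S\<close> one has \<open>D\<^sup>* D = - V\<^sup>-\<^sup>1 S\<^sup>-\<^sup>1 D\<^sup>2\<close>; since \<open>T\<close> and \<open>S\<close> need not be invertible, everything is
  multiplied by \<open>T ^^ R\<close> and \<open>S\<close>. As \<open>\<beta> (u i) (u j)\<close> is controlled by \<open>D (r i) (D (r j) h)\<close>, these vectors
  are almost orthogonal, so their inner products \<open>q (D (r i) h)\<^sup>2\<close> with the fixed vector \<open>w\<close> cannot all
  be large.
\<close>

lemma sum_q_D_square_le:
  fixes r :: "nat \<Rightarrow> nat"
  assumes L: "q h \<le> L"
    and \<eta>: "\<And>i j. i < N \<Longrightarrow> j < N \<Longrightarrow> i \<noteq> j \<Longrightarrow> q (D (r i) (D (r j) h)) \<le> \<eta>"
    and "0 \<le> \<eta>"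
  shows "(\<Sum>i<N. (q (D (r i) h))\<^sup>2)\<^sup>2 \<le> L\<^sup>2 * (16 * real N * L\<^sup>2 + 4 * (real N)\<^sup>2 * L * \<eta>)"
proof -
  \<comment> \<open>\<open>R\<close> serves only as a common upper bound of the exponents
    \<open>r i\<close>.\<close>
  define R where "R = (\<Sum>i<N. r i)"
  have R: "r i \<le> R" if "i < N" for i
    using that by (auto simp: R_def intro: member_le_sum)
  define u where "u i = - (T ^^ (R - r i)) (D (r i) (D (r i) h))" for i
  define w where "w = (T ^^ R) (S h)"
  have L0: "0 \<le> L" using L q_nonneg order_trans by blast
  have w: "q w \<le> L" by (simp add: w_def q_funpow q_S L)
  have shift: "(T ^^ r i) (u i) = - (T ^^ R) (D (r i) (D (r i) h))" if "i < N" for i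
    using R[OF that] by (simp add: u_def funpow_simps flip: funpow_add[THEN fun_cong, unfolded o_apply])
  have uw: "\<beta> (u i) w = (q (D (r i) h))\<^sup>2" if "i < N" for i
  proof -
    have "\<beta> (u i) w = \<beta> ((T ^^ r i) (u i)) ((T ^^ r i) w)" by (simp add: isometry_funpow)
    also have "\<dots> = - \<beta> (D (r i) ((T ^^ R) (D (r i) h))) ((T ^^ r i) (S ((T ^^ R) h)))"
      by (simp add: shift[OF that] w_def minus_left D_funpow commute_funpow)
    also have "\<dots> = \<beta> ((T ^^ R) (D (r i) h)) (D (r i) ((T ^^ R) h))"
      by (simp only: D_adjoint minus_minus)
    finally show ?thesis by (simp add: D_funpow isometry_funpow q_square)
  qed
  have uu: "\<beta> (u i) (u j) \<le> (if i = j then 16 * L\<^sup>2 else 4 * L * \<eta>)" if "i < N" "j < N" for i j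
  proof (cases "i = j")
    case True
    have "q (u j) \<le> 4 * L"
      using q_D_le[of "r j" "D (r j) h"] q_D_le[of "r j" h] L by (simp add: u_def q_minus q_funpow)
    then have "(q (u j))\<^sup>2 \<le> (4 * L)\<^sup>2" by (intro power_mono q_nonneg)
    then show ?thesis using True by (simp add: q_square power_mult_distrib)
  next
    case False
    \<comment> \<open>Applying the isometries \<open>T ^^ r i\<close> and \<open>S\<close> to both
      arguments brings the pairing into the shape of \<open>D_adjoint\<close>.\<close>
    have "\<beta> (u i) (u j) = \<beta> (S ((T ^^ r i) (u i))) (S ((T ^^ r i) (u j)))"
      by (simp add: isometry_funpow isometry_S)
    also have "\<dots> = - \<beta> (D (r i) (S ((T ^^ R) (D (r i) h)))) ((T ^^ r i) (S (u j)))"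
      by (simp add: shift[OF that(1)] S_simps minus_left D_S D_funpow commute_funpow)
    also have "\<dots> = \<beta> (S ((T ^^ R) (D (r i) h))) (D (r i) (u j))"
      by (simp only: D_adjoint minus_minus)
    also have "\<dots> \<le> q (D (r i) h) * q (D (r i) (u j))"
      using Cauchy_Schwarz[of "S ((T ^^ R) (D (r i) h))" "D (r i) (u j)"] by (simp add: q_S q_funpow)
    also have "q (D (r i) (u j)) = q (D (r j) (D (r i) (D (r j) h)))"
      by (simp add: u_def D_neg q_minus D_funpow q_funpow D_commute)
    also have "q (D (r i) h) * \<dots> \<le> (2 * L) * (2 * \<eta>)"
      using q_D_le[of "r i" h] q_D_le[of "r j" "D (r i) (D (r j) h)"] L \<eta>[OF that False] L0
      by (intro mult_mono) (auto simp: q_nonneg)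
    finally show ?thesis using False by simp
  qed
  have "\<beta> (\<Sum>i<N. u i) (\<Sum>j<N. u j) = (\<Sum>i<N. \<Sum>j<N. \<beta> (u i) (u j))"
    by (simp only: sum_left) (simp only: sum_right)
  also have "\<dots> \<le> (\<Sum>i<N. \<Sum>j<N. (if i = j then 16 * L\<^sup>2 else 0) + 4 * L * \<eta>)"
  proof (intro sum_mono)
    fix i j assume ij: "i \<in> {..<N}" "j \<in> {..<N}"
    have "0 \<le> 4 * L * \<eta>" using L0 assms(3) by simp
    then show "\<beta> (u i) (u j) \<le> (if i = j then 16 * L\<^sup>2 else 0) + 4 * L * \<eta>"
      using uu[of i j] ij by (auto split: if_splits)
  qed
  also have "\<dots> = 16 * real N * L\<^sup>2 + 4 * (real N)\<^sup>2 * L * \<eta>"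
    by (simp add: sum.distrib power2_eq_square algebra_simps)
  finally have sum_u: "\<beta> (\<Sum>i<N. u i) (\<Sum>j<N. u j) \<le> 16 * real N * L\<^sup>2 + 4 * (real N)\<^sup>2 * L * \<eta>" .
  have "(\<Sum>i<N. (q (D (r i) h))\<^sup>2) = \<beta> (\<Sum>i<N. u i) w"
    by (simp add: sum_left uw)
  then have "(\<Sum>i<N. (q (D (r i) h))\<^sup>2)\<^sup>2 \<le> \<beta> w w * \<beta> (\<Sum>i<N. u i) (\<Sum>j<N. u j)"
    using Cauchy_Schwarz_square[of "\<Sum>i<N. u i" w] by (simp add: mult.commute)
  also have "\<dots> \<le> L\<^sup>2 * (16 * real N * L\<^sup>2 + 4 * (real N)\<^sup>2 * L * \<eta>)"
    using sum_u w by (intro mult_mono) (auto simp: nonneg power_mono q_nonneg simp flip: q_square)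
  finally show ?thesis .
qed


text \<open>
  If every \<open>D (r i)\<close> is small on \<open>x + i y\<close>, then a product \<open>D (r i) D (r j)\<close> with \<open>i \<noteq> j\<close> is small on two
  different combinations of \<open>x\<close> and \<open>y\<close>, hence on \<open>x\<close> and on \<open>y\<close>.
\<close>

lemma pencil_small:
  assumes "0 < e"
  shows "\<exists>(N :: nat) \<delta>. 0 < \<delta> \<and>
    (\<forall>r. (\<forall>i<N. q (D (r i) (x + real i *\<^sub>R y)) \<le> \<delta>) \<longrightarrow>
      (\<exists>i<N. q (D (r i) x) < e \<and> q (D (r i) y) < e))"
proof -
  define L where "L = q x + q y + 1"
  have L: "0 < L" "q x \<le> L" "q y \<le> L"
    using q_nonneg[of x] q_nonneg[of y] by (auto simp: L_def)
  \<comment> \<open>\<open>N\<close> and \<open>\<eta>\<close> are tuned to the final inequality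
    \<open>N^2 e^4 \<le> 64 N L^4 + 16 N^2 L^3 \<eta>\<close>: the last term becomes half of the
    left side, and \<open>N\<close> is too large for the other one.\<close>
  obtain N :: nat where N: "128 * L ^ 4 / e ^ 4 < real N"
    using reals_Archimedean2 by blast
  have "0 \<le> 128 * L ^ 4 / e ^ 4" by simp
  with N have N0: "0 < real N" by linarith
  define \<eta> where "\<eta> = e ^ 4 / (32 * L ^ 3)"
  \<comment> \<open>The bound found below for \<open>q ?x\<close> is
    \<open>2 \<delta> + 4 N \<delta>\<close>, which is exactly \<open>\<eta>\<close>.\<close>
  define \<delta> where "\<delta> = \<eta> / (4 * real N + 2)"
  have \<eta>0: "0 < \<eta>" using assms L by (simp add: \<eta>_def)
  have \<delta>0: "0 < \<delta>" using \<eta>0 N0 by (simp add: \<delta>_def)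
  have \<delta>\<eta>: "\<delta> * (4 * real N + 2) = \<eta>" using N0 by (simp add: \<delta>_def)
  show ?thesis
  proof (rule exI[of _ N], rule exI[of _ \<delta>], intro conjI allI impI, rule \<delta>0)
    fix r :: "nat \<Rightarrow> nat"
    assume "\<forall>i<N. q (D (r i) (x + real i *\<^sub>R y)) \<le> \<delta>"
    then have r: "q (D (r i) (x + real i *\<^sub>R y)) \<le> \<delta>" if "i < N" for i
      using that by blast
    show "\<exists>i<N. q (D (r i) x) < e \<and> q (D (r i) y) < e"
    proof (rule ccontr)
      assume *: "\<not> ?thesis"
      have big: "e\<^sup>2 \<le> (q (D (r i) x))\<^sup>2 + (q (D (r i) y))\<^sup>2" if "i < N" for i
      proof (cases "q (D (r i) x) < e")
        case True
        with * that have "e \<le> q (D (r i) y)" by force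
        then show ?thesis using assms power_mono[of e "q (D (r i) y)" 2] by (simp add: add_increasing)
      next
        case False
        then show ?thesis using assms power_mono[of e "q (D (r i) x)" 2] by (simp add: add_increasing2)
      qed
      have DD: "q (D (r i) (D (r j) x)) \<le> \<eta>" "q (D (r i) (D (r j) y)) \<le> \<eta>"
        if ij: "i < N" "j < N" "i \<noteq> j" for i j
      proof -
        let ?x = "D (r i) (D (r j) x)" and ?y = "D (r i) (D (r j) y)"
        have i: "q (?x + real i *\<^sub>R ?y) \<le> 2 * \<delta>"
          using q_D_le[of "r j" "D (r i) (x + real i *\<^sub>R y)"] r[OF ij(1)]
          by (simp add: D_add D_scale D_commute[of "r j"])
        have j: "q (?x + real j *\<^sub>R ?y) \<le> 2 * \<delta>"
          using q_D_le[of "r i" "D (r j) (x + real j *\<^sub>R y)"] r[OF ij(2)]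
          by (simp add: D_add D_scale)
        \<comment> \<open>Subtracting the two pencil vectors leaves \<open>(i - j) ?y\<close>, and
          distinct integers differ by at least 1.\<close>
        have "1 * q ?y \<le> \<bar>real i - real j\<bar> * q ?y"
          using ij(3) by (intro mult_right_mono q_nonneg) linarith
        also have "\<dots> = q ((?x + real i *\<^sub>R ?y) - (?x + real j *\<^sub>R ?y))"
          by (simp add: q_scale flip: scaleR_diff_left)
        also have "\<dots> \<le> 4 * \<delta>"
          using q_diff_le[of "?x + real i *\<^sub>R ?y" "?x + real j *\<^sub>R ?y"] i j by linarith
        finally have y: "q ?y \<le> 4 * \<delta>" by simp
        have "q ?x \<le> q (?x + real i *\<^sub>R ?y) + real i * q ?y"
          using q_diff_le[of "?x + real i *\<^sub>R ?y" "real i *\<^sub>R ?y"] by (simp add: q_scale)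
        also have "\<dots> \<le> 2 * \<delta> + real N * (4 * \<delta>)"
          using i y ij(1) q_nonneg by (intro add_mono mult_mono) auto
        also have "\<dots> = \<eta>"
          unfolding \<delta>\<eta>[symmetric] by (simp add: algebra_simps)
        finally show "q ?x \<le> \<eta>" .
        have "4 * \<delta> \<le> \<eta>"
          unfolding \<delta>\<eta>[symmetric] using N0 \<delta>0 by simp
        with y show "q ?y \<le> \<eta>" by linarith
      qed
      define A where "A = (\<Sum>i<N. (q (D (r i) x))\<^sup>2)"
      define B where "B = (\<Sum>i<N. (q (D (r i) y))\<^sup>2)"
      define C where "C = L\<^sup>2 * (16 * real N * L\<^sup>2 + 4 * (real N)\<^sup>2 * L * \<eta>)"
      have AB: "A\<^sup>2 \<le> C" "B\<^sup>2 \<le> C"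
        using sum_q_D_square_le[OF L(2) DD(1)] sum_q_D_square_le[OF L(3) DD(2)] \<eta>0
        by (auto simp: A_def B_def C_def)
      have "real N * e\<^sup>2 \<le> A + B"
        using sum_bounded_below[of "{..<N}" "e\<^sup>2" "\<lambda>i. (q (D (r i) x))\<^sup>2 + (q (D (r i) y))\<^sup>2"] big
        by (simp add: A_def B_def sum.distrib)
      then have "(real N * e\<^sup>2)\<^sup>2 \<le> (A + B)\<^sup>2"
        by (intro power_mono) auto
      also have "\<dots> \<le> 2 * A\<^sup>2 + 2 * B\<^sup>2"
        using zero_le_power2[of "A - B"] by (simp add: power2_sum power2_diff)
      also have "\<dots> \<le> 4 * C" using AB by linarith
      also have "4 * C = 64 * real N * L ^ 4 + (real N)\<^sup>2 * e ^ 4 / 2"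
        using L(1) by (simp add: C_def \<eta>_def field_simps power2_eq_square power3_eq_cube power4_eq_xxxx)
      also have "(real N * e\<^sup>2)\<^sup>2 = (real N)\<^sup>2 * e ^ 4"
        by (simp add: power_mult_distrib flip: power_mult)
      finally have "real N * (real N * e ^ 4) \<le> real N * (128 * L ^ 4)"
        by (simp add: power2_eq_square)
      then have "real N * e ^ 4 \<le> 128 * L ^ 4" using N0 by simp
      then show False using N assms by (simp add: field_simps)
    qed
  qed
qed

end

section \<open>Pointwise limits of orbits\<close>

text \<open>The form is the Banach limit of \<open>inner ((T ^^ n) x) ((T ^^ n) y)\<close>, and
  shift invariance makes \<open>T\<close> isometric. The clause on \<open>J\<close> is meant for
  multiplication by \<open>\<i>\<close>: it lets the real form be treated as the real part of a
  sesquilinear one.\<close>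

lemma invariant_form_exists:
  fixes T :: "'a::real_inner \<Rightarrow> 'a"
  assumes T: "linear T" and bound: "\<And>n x. norm ((T ^^ n) x) \<le> M * norm x"
  obtains \<beta> where "semi_inner \<beta>" "\<And>x y. \<beta> (T x) (T y) = \<beta> x y"
    "\<And>x. \<beta> x x \<le> (M * norm x)\<^sup>2"
    "\<And>x c. 0 \<le> c \<Longrightarrow> (\<And>n. c \<le> norm ((T ^^ n) x)) \<Longrightarrow> c\<^sup>2 \<le> \<beta> x x"
    "\<And>J x y. (\<And>x y. inner (J x) (J y) = inner x y) \<Longrightarrow> (\<And>x. T (J x) = J (T x)) \<Longrightarrow>
      \<beta> (J x) (J y) = \<beta> x y"
proof -
  obtain L :: "(nat \<Rightarrow> real) \<Rightarrow> real" where
    L_add: "\<And>f g. Bseq f \<Longrightarrow> Bseq g \<Longrightarrow> L (\<lambda>n. f n + g n) = L f + L g"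
    and L_scale: "\<And>c f. Bseq f \<Longrightarrow> L (\<lambda>n. c * f n) = c * L f"
    and L_shift: "\<And>f. Bseq f \<Longrightarrow> L (\<lambda>n. f (Suc n)) = L f"
    and L_lower: "\<And>c f. Bseq f \<Longrightarrow> (\<And>n. c \<le> f n) \<Longrightarrow> c \<le> L f"
    using banach_limit_exists by blast
  note lin = linear_funpow[OF T]
  define \<beta> where "\<beta> x y = L (\<lambda>n. inner ((T ^^ n) x) ((T ^^ n) y))" for x y
  have bounded: "Bseq (\<lambda>n. inner ((T ^^ n) x) ((T ^^ n) y))" for x y
  proof (rule BseqI')
    fix n
    have "norm (inner ((T ^^ n) x) ((T ^^ n) y)) \<le> norm ((T ^^ n) x) * norm ((T ^^ n) y)"
      by (simp add: Cauchy_Schwarz_ineq2)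
    also have "\<dots> \<le> (M * norm x) * (M * norm y)"
      by (intro mult_mono bound order_trans[OF norm_ge_zero bound]) auto
    finally show "norm (inner ((T ^^ n) x) ((T ^^ n) y)) \<le> (M * norm x) * (M * norm y)" .
  qed
  show ?thesis
  proof
    show "semi_inner \<beta>"
    proof
      fix x y z :: 'a and r :: real
      show "\<beta> (x + y) z = \<beta> x z + \<beta> y z"
        by (simp add: \<beta>_def linear_add[OF lin] inner_add_left L_add bounded)
      show "\<beta> (r *\<^sub>R x) z = r * \<beta> x z"
        by (simp add: \<beta>_def linear_cmul[OF lin] L_scale bounded)
      show "\<beta> x y = \<beta> y x"
        by (simp add: \<beta>_def inner_commute)
      show "0 \<le> \<beta> x x"
        unfolding \<beta>_def by (rule L_lower[OF bounded]) simp
    qed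
    show "\<beta> (T x) (T y) = \<beta> x y" for x y
      using L_shift[OF bounded[of x y]] by (simp add: \<beta>_def funpow_swap1)
    show "\<beta> x x \<le> (M * norm x)\<^sup>2" for x
    proof -
      \<comment> \<open>The upper bound comes from the lower-bound property of \<open>L\<close>
        applied to the negated sequence.\<close>
      have "- ((M * norm x)\<^sup>2) \<le> - inner ((T ^^ n) x) ((T ^^ n) x)" for n
        using power_mono[OF bound[of n x] norm_ge_zero, of 2] by (simp add: power2_norm_eq_inner)
      then have "- ((M * norm x)\<^sup>2) \<le> L (\<lambda>n. - 1 * inner ((T ^^ n) x) ((T ^^ n) x))"
        by (intro L_lower) (use bounded[of x x] in \<open>simp_all add: Bseq_def\<close>)
      then show ?thesis unfolding L_scale[OF bounded] by (simp add: \<beta>_def)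
    qed
    show "c\<^sup>2 \<le> \<beta> x x" if "0 \<le> c" "\<And>n. c \<le> norm ((T ^^ n) x)" for x c
    proof -
      have "c\<^sup>2 \<le> inner ((T ^^ n) x) ((T ^^ n) x)" for n
        using power_mono[OF that(2) that(1), of 2 n] by (simp only: power2_norm_eq_inner)
      then show ?thesis unfolding \<beta>_def by (intro L_lower bounded)
    qed
    show "\<beta> (J x) (J y) = \<beta> x y"
      if J: "\<And>x y. inner (J x) (J y) = inner x y" "\<And>x. T (J x) = J (T x)" for J x y
    proof -
      have "(T ^^ n) (J x) = J ((T ^^ n) x)" for n x
        by (induction n) (auto simp: J(2))
      then show ?thesis by (simp add: \<beta>_def J(1))
    qed
  qed
qed

section \<open>Operators that are pointwise limits of late powers\<close>

lemma scaleC_ii_ii: "\<i> *\<^sub>C (\<i> *\<^sub>C x) = - (x :: 'a::complex_vector_space)"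
  using scaleC_of_real[of "-1" x] by (simp add: scaleC_scaleC)

text \<open>The exponent in \<open>orbit_limit\<close> depends on the vector; the goal of the locale
  is one exponent for finitely many vectors.\<close>

locale orbit_limit = semi_inner \<beta> for \<beta> :: "'a::complex_inner_space \<Rightarrow> 'a \<Rightarrow> real" +
  fixes T S :: "'a \<Rightarrow> 'a" and M :: real
  assumes bounded_linear_T: "bounded_linear T" and bounded_linear_S: "bounded_linear S"
    and T_scaleC: "T (c *\<^sub>C x) = c *\<^sub>C T x" and S_scaleC: "S (c *\<^sub>C x) = c *\<^sub>C S x"
    and power_bound: "norm ((T ^^ n) x) \<le> M * norm x" and M_ge_1: "1 \<le> M"
    and isometry: "\<beta> (T x) (T y) = \<beta> x y"
    and isometry_ii: "\<beta> (\<i> *\<^sub>C x) (\<i> *\<^sub>C y) = \<beta> x y"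
    and form_le: "\<beta> x x \<le> (M * norm x)\<^sup>2"
    and form_ge: "0 \<le> r \<Longrightarrow> (\<And>n. r \<le> norm ((T ^^ n) x)) \<Longrightarrow> r\<^sup>2 \<le> \<beta> x x"
    and orbit_limit: "0 < e \<Longrightarrow> \<exists>n\<ge>m. norm ((T ^^ n) x - S x) < e"
begin

lemmas linear_T = bounded_linear.linear[OF bounded_linear_T]
lemmas linear_S = bounded_linear.linear[OF bounded_linear_S]
lemmas S_add = linear_add[OF linear_S] and S_diff = linear_diff[OF linear_S]
lemmas T_add = linear_add[OF linear_T] and T_diff = linear_diff[OF linear_T]
lemmas pow_diff = linear_diff[OF linear_funpow[OF linear_T]]

lemma q_le_norm: "q x \<le> M * norm x"
  by (rule power2_le_imp_le) (use form_le[of x] M_ge_1 in \<open>simp_all add: q_square\<close>)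

lemma isometry_pow: "\<beta> ((T ^^ n) x) ((T ^^ n) y) = \<beta> x y"
  by (induction n) (auto simp: isometry)

lemma bounded_bilinear_form: "bounded_bilinear \<beta>"
proof
  show "\<exists>K. \<forall>x y. norm (\<beta> x y) \<le> norm x * norm y * K"
  proof (intro exI allI)
    fix x y
    have "norm (\<beta> x y) \<le> q x * q y" using Cauchy_Schwarz by simp
    also have "\<dots> \<le> (M * norm x) * (M * norm y)"
      using M_ge_1 by (intro mult_mono q_le_norm) (auto simp: q_nonneg)
    finally show "norm (\<beta> x y) \<le> norm x * norm y * (M * M)" by (simp add: mult_ac)
  qed
qed (simp_all add: add_left add_right scale_left scale_right)

lemma orbit_sequence: obtains f where "(\<lambda>k. (T ^^ f k) x) \<longlonglongrightarrow> S x"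
proof -
  have "\<forall>k. \<exists>n. norm ((T ^^ n) x - S x) < inverse (real (Suc k))"
    using orbit_limit[of "inverse (real (Suc _))" 0 x] by (simp del: of_nat_Suc)
  then obtain f where f: "\<And>k. norm ((T ^^ f k) x - S x) < inverse (real (Suc k))"
    by metis
  have "(\<lambda>k. (T ^^ f k) x - S x) \<longlonglongrightarrow> 0"
    by (rule Lim_null_comparison[OF always_eventually LIMSEQ_inverse_real_of_nat])
      (use f less_imp_le in blast)
  then show ?thesis using that LIM_zero_iff by blast
qed

text \<open>The value \<open>\<beta> (A z) (B z)\<close> is constant along the orbit of
  \<open>x\<close>, since \<open>A\<close> and \<open>B\<close> commute with the isometry
  \<open>T\<close>, and continuity carries it to \<open>S x\<close>. Both arguments use the same
  \<open>x\<close> because the approximating exponents depend on it.\<close>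

lemma form_orbit_limit:
  assumes A: "bounded_linear A" and B: "bounded_linear B"
    and AT: "\<And>x. A (T x) = T (A x)" and BT: "\<And>x. B (T x) = T (B x)"
  shows "\<beta> (A (S x)) (B (S x)) = \<beta> (A x) (B x)"
proof -
  obtain f where f: "(\<lambda>k. (T ^^ f k) x) \<longlonglongrightarrow> S x" by (rule orbit_sequence)
  have *: "A ((T ^^ n) x) = (T ^^ n) (A x)" "B ((T ^^ n) x) = (T ^^ n) (B x)" for n
    by (induction n) (auto simp: AT BT)
  have "(\<lambda>k. \<beta> (A ((T ^^ f k) x)) (B ((T ^^ f k) x))) \<longlonglongrightarrow> \<beta> (A (S x)) (B (S x))"
    by (intro bounded_bilinear.tendsto[OF bounded_bilinear_form] bounded_linear.tendsto[OF A]
        bounded_linear.tendsto[OF B] f)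
  then show ?thesis by (simp add: * isometry_pow LIMSEQ_const_iff)
qed

lemma form_S: "\<beta> (S x) (S y) = \<beta> x y"
proof (rule isometry_polarization[OF linear_S])
  show "q (S x) = q x" for x
    using form_orbit_limit[of "\<lambda>x. x" "\<lambda>x. x"] by (simp add: q_def bounded_linear_ident)
qed

text \<open>
  The difference of the two sides is the real part of a sesquilinear form in \<open>x\<close> and \<open>y\<close> whose quadratic
  form vanishes.
\<close>

lemma form_S_T: "\<beta> (S x) (T (S y)) = \<beta> x (T y)"
proof -
  define b where "b x y = \<beta> (S x) (T (S y)) - \<beta> x (T y)" for x y
  have b_add: "b (x + x') y = b x y + b x' y" "b x (y + y') = b x y + b x y'" for x x' y y'
    by (simp_all add: b_def S_add T_add add_left add_right)
  have b_minus: "b (- x) y = - b x y" "b x (- y) = - b x y" for x y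
    by (simp_all add: b_def linear_neg[OF linear_S] linear_neg[OF linear_T] minus_left minus_right)
  have b_ii_ii: "b (\<i> *\<^sub>C x) (\<i> *\<^sub>C y) = b x y" for x y
    by (simp add: b_def S_scaleC T_scaleC isometry_ii)
  have diag: "b x x = 0" for x
    using form_orbit_limit[OF bounded_linear_ident bounded_linear_T]
    by (simp add: b_def)
  have diag_ii: "b (\<i> *\<^sub>C x) x = 0" for x
    using form_orbit_limit[OF bounded_linear_scaleC bounded_linear_T, of \<i> x]
    by (simp add: b_def S_scaleC T_scaleC)
  have anti: "b y x = - b x y" for x y
    using diag[of "x + y"] diag[of x] diag[of y] unfolding b_add by linarith
  have anti_ii: "b (\<i> *\<^sub>C y) x = - b (\<i> *\<^sub>C x) y" for x y
    using diag_ii[of "x + y"] diag_ii[of x] diag_ii[of y] unfolding scaleC_add_right b_add by linarith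
  \<comment> \<open>The two antisymmetries give \<open>b (\<i> x) y = b x (\<i> y)\<close>, while
    invariance under \<open>\<i>\<close> gives the opposite sign.\<close>
  have "b (\<i> *\<^sub>C x) y = 0" for x y
    using anti_ii[of y x] anti[of x "\<i> *\<^sub>C y"] b_ii_ii[of x "\<i> *\<^sub>C y"]
    by (simp add: scaleC_ii_ii b_minus)
  from this[of "\<i> *\<^sub>C (- x)" y] have "b x y = 0" by (simp add: scaleC_ii_ii)
  then show ?thesis by (simp add: b_def)
qed

text \<open>Expanding the square, both diagonal terms and the cross term, by \<open>form_S_T\<close>
  at \<open>T x\<close> and \<open>x\<close>, equal \<open>\<beta> x x\<close>.\<close>

lemma q_commutator: "q (T (S x) - S (T x)) = 0"
proof -
  have "(q (T (S x) - S (T x)))\<^sup>2 = 0"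
    by (simp add: q_square diff_left diff_right sym[of "T (S x)" "S (T x)"] isometry form_S form_S_T)
  then show ?thesis by simp
qed

text \<open>By \<open>form_ge\<close> the norms along the orbit cannot all exceed \<open>q x\<close>
  by a fixed amount. Once one power is small, the power bound controls all later ones at the cost of
  a factor \<open>M\<close>.\<close>

lemma norm_pow_eventually_le:
  assumes "0 < e"
  shows "\<exists>m. \<forall>n\<ge>m. norm ((T ^^ n) x) \<le> M * q x + e"
proof -
  have "\<exists>m. norm ((T ^^ m) x) < q x + e / M"
  proof (rule ccontr)
    assume *: "\<not> ?thesis"
    have "q x + e / M \<le> norm ((T ^^ n) x)" for n using * not_less by blast
    then have "(q x + e / M)\<^sup>2 \<le> (q x)\<^sup>2"
      unfolding q_square using form_ge[of "q x + e / M" x] assms M_ge_1 q_nonneg[of x] by simp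
    then have "q x + e / M \<le> q x" by (rule power2_le_imp_le[OF _ q_nonneg])
    then show False using assms M_ge_1 by (simp add: field_simps)
  qed
  then obtain m where m: "norm ((T ^^ m) x) < q x + e / M" by blast
  show ?thesis
  proof (intro exI allI impI)
    fix n assume "m \<le> n"
    then have "(T ^^ n) x = (T ^^ (n - m)) ((T ^^ m) x)"
      by (metis comp_apply funpow_add le_add_diff_inverse2)
    then have "norm ((T ^^ n) x) \<le> M * norm ((T ^^ m) x)" using power_bound by simp
    also have "\<dots> \<le> M * (q x + e / M)" using m M_ge_1 by simp
    finally show "norm ((T ^^ n) x) \<le> M * q x + e"
      using M_ge_1 by (simp add: distrib_left)
  qed
qed

text \<open>The powers approximating \<open>S x\<close> can be taken beyond the threshold of
  \<open>norm_pow_eventually_le\<close>.\<close>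

lemma norm_S_le: "norm (S x) \<le> M * q x"
proof (rule field_le_epsilon)
  fix e :: real assume "0 < e"
  then have e: "0 < e / 2" by simp
  obtain m where m: "\<And>n. m \<le> n \<Longrightarrow> norm ((T ^^ n) x) \<le> M * q x + e / 2"
    using norm_pow_eventually_le[OF e, of x] by blast
  obtain n where n: "m \<le> n" "norm ((T ^^ n) x - S x) < e / 2"
    using orbit_limit[OF e] by blast
  have "norm (S x) \<le> norm ((T ^^ n) x) + norm ((T ^^ n) x - S x)"
    by (metis norm_minus_commute norm_triangle_sub)
  then show "norm (S x) \<le> M * q x + e" using m[OF n(1)] n(2) by linarith
qed

section \<open>Recurrent vectors and commutation of \<open>T\<close> with \<open>S\<close>\<close>

definition recurrent :: "'a \<Rightarrow> bool"
  where "recurrent x \<longleftrightarrow> (\<forall>e>0. \<forall>m. \<exists>n\<ge>m. norm ((T ^^ n) x - x) < e)"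

text \<open>If \<open>T ^^ k\<close> and a much later \<open>T ^^ l\<close> both send
  \<open>x\<close> near \<open>S x\<close>, then \<open>T ^^ (l - k)\<close> sends
  \<open>S x\<close> near itself.\<close>

lemma recurrent_S: "recurrent (S x)"
  unfolding recurrent_def
proof (intro allI impI)
  fix e :: real and m :: nat assume "0 < e"
  define d where "d = e / (M + 1)"
  have "0 < d" "(M + 1) * d = e" using \<open>0 < e\<close> M_ge_1 by (simp_all add: d_def)
  then have d: "0 < d" "M * d + d = e" by (simp_all add: algebra_simps)
  obtain k where k: "norm ((T ^^ k) x - S x) < d" using orbit_limit[OF d(1)] by blast
  obtain l where l: "k + m \<le> l" "norm ((T ^^ l) x - S x) < d" using orbit_limit[OF d(1)] by blast
  have "(T ^^ l) x = (T ^^ (l - k)) ((T ^^ k) x)"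
    using l(1) by (metis comp_apply funpow_add le_add_diff_inverse2 add_leD1)
  then have "(T ^^ (l - k)) (S x) - S x = ((T ^^ l) x - S x) - (T ^^ (l - k)) ((T ^^ k) x - S x)"
    by (simp add: pow_diff)
  then have "norm ((T ^^ (l - k)) (S x) - S x) \<le> norm ((T ^^ l) x - S x) + norm ((T ^^ (l - k)) ((T ^^ k) x - S x))"
    by (metis norm_triangle_ineq4)
  also have "\<dots> < d + M * d"
    using l(2) power_bound[of "l - k" "(T ^^ k) x - S x"] mult_left_mono[OF less_imp_le[OF k], of M] M_ge_1
    by linarith
  finally have "norm ((T ^^ (l - k)) (S x) - S x) < e" using d(2) by simp
  then show "\<exists>n\<ge>m. norm ((T ^^ n) (S x) - S x) < e" using l(1) by (intro exI[of _ "l - k"]) auto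
qed

lemma recurrent_T:
  assumes "recurrent x"
  shows "recurrent (T x)"
  unfolding recurrent_def
proof (intro allI impI)
  fix e :: real and m :: nat assume "0 < e"
  then have "0 < e / M" using M_ge_1 by simp
  then obtain n where n: "m \<le> n" "norm ((T ^^ n) x - x) < e / M"
    using assms unfolding recurrent_def by blast
  have "norm ((T ^^ n) (T x) - T x) \<le> M * norm ((T ^^ n) x - x)"
    using power_bound[of 1 "(T ^^ n) x - x"] by (simp add: T_diff funpow_swap1)
  also have "\<dots> < e" using n(2) M_ge_1 by (simp add: field_simps)
  finally show "\<exists>n\<ge>m. norm ((T ^^ n) (T x) - T x) < e" using n(1) by blast
qed

text \<open>
  With \<open>T\<^sup>a x\<close> close to \<open>x\<close> and \<open>T\<^sup>b y\<close> close to \<open>y\<close>, the vector \<open>T\<^sup>a\<^sup>+\<^sup>b y\<close> is close to both.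
\<close>

lemma recurrent_eqI:
  assumes x: "recurrent x" and y: "recurrent y" and q: "q (x - y) = 0"
  shows "x = y"
proof -
  have "norm (x - y) \<le> e" if "0 < e" for e
  proof -
    define d where "d = e / (2 * M + 5)"
    have "0 < d" "(2 * M + 5) * d = e" using that M_ge_1 by (simp_all add: d_def)
    then have d: "0 < d" "2 * (M * d) + 5 * d = e" by (simp_all add: algebra_simps)
    \<comment> \<open>Here \<open>q (x - y) = 0\<close> enters: all late powers nearly annihilate
      \<open>x - y\<close> in norm.\<close>
    obtain m where m: "\<And>n. m \<le> n \<Longrightarrow> norm ((T ^^ n) (x - y)) \<le> d"
      using norm_pow_eventually_le[OF d(1), of "x - y"] q by auto
    obtain a where a: "m \<le> a" "norm ((T ^^ a) x - x) < d"
      using x d(1) unfolding recurrent_def by blast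
    obtain b where b: "m \<le> b" "norm ((T ^^ b) y - y) < d"
      using y d(1) unfolding recurrent_def by blast
    have 1: "norm ((T ^^ a) ((T ^^ b) y - y)) \<le> M * d" "norm ((T ^^ b) ((T ^^ a) x - x)) \<le> M * d"
      using a b M_ge_1 by (auto intro!: order_trans[OF power_bound] mult_left_mono)
    have comm: "(T ^^ a) ((T ^^ b) y) = (T ^^ b) ((T ^^ a) y)"
      by (metis add.commute comp_apply funpow_add)
    have 2: "norm ((T ^^ b) ((T ^^ a) (x - y))) \<le> d"
      using m[of "b + a"] a(1) by (simp add: funpow_add)
    have eq_x: "(T ^^ a) ((T ^^ b) y) - x = (T ^^ a) ((T ^^ b) y - y) - (T ^^ a) (x - y) + ((T ^^ a) x - x)"
      by (simp add: pow_diff)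
    have x: "norm ((T ^^ a) ((T ^^ b) y) - x) \<le> M * d + 2 * d"
      unfolding eq_x using norm_triangle_ineq[of "(T ^^ a) ((T ^^ b) y - y) - (T ^^ a) (x - y)" "(T ^^ a) x - x"]
        norm_triangle_ineq4[of "(T ^^ a) ((T ^^ b) y - y)" "(T ^^ a) (x - y)"] 1 m[OF a(1)] a(2)
      by linarith
    have eq_y: "(T ^^ a) ((T ^^ b) y) - y =
        (T ^^ b) ((T ^^ a) x - x) - (T ^^ b) ((T ^^ a) (x - y)) + ((T ^^ b) (x - y) + ((T ^^ b) y - y))"
      by (simp add: pow_diff comm)
    have y: "norm ((T ^^ a) ((T ^^ b) y) - y) \<le> M * d + 3 * d"
      unfolding eq_y using norm_triangle_ineq[of "(T ^^ b) ((T ^^ a) x - x) - (T ^^ b) ((T ^^ a) (x - y))"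
          "(T ^^ b) (x - y) + ((T ^^ b) y - y)"]
        norm_triangle_ineq4[of "(T ^^ b) ((T ^^ a) x - x)" "(T ^^ b) ((T ^^ a) (x - y))"]
        norm_triangle_ineq[of "(T ^^ b) (x - y)" "(T ^^ b) y - y"] 1 2 m[OF b(1)] b(2)
      by linarith
    have "norm (x - y) \<le> norm ((T ^^ a) ((T ^^ b) y) - y) + norm ((T ^^ a) ((T ^^ b) y) - x)"
      using norm_triangle_ineq4[of "(T ^^ a) ((T ^^ b) y) - y" "(T ^^ a) ((T ^^ b) y) - x"] by simp
    with x y d(2) show "norm (x - y) \<le> e" by linarith
  qed
  then have "norm (x - y) \<le> 0" by - (rule field_le_epsilon, simp)
  then show ?thesis by simp
qed

lemma T_S: "T (S x) = S (T x)"
  by (rule recurrent_eqI[OF recurrent_T[OF recurrent_S] recurrent_S q_commutator])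

section \<open>Simultaneous approximation on finite sets\<close>

sublocale isometry_family \<beta> T S
  by (rule isometry_family.intro isometry_family_axioms.intro semi_inner_axioms linear_T linear_S
      isometry form_S T_S)+

text \<open>Induction with a distinguished vector \<open>x\<close>: to add \<open>y\<close>, the
  hypothesis is applied to \<open>x + i y\<close> in place of \<open>x\<close> for each
  \<open>i\<close>, giving exponents \<open>r i\<close> good on \<open>F\<close>. Then
  \<open>pencil_small\<close> selects one of them that is good on both \<open>x\<close> and
  \<open>y\<close>.\<close>

lemma D_simultaneously_small:
  assumes "finite F"
  shows "0 < e \<Longrightarrow> \<exists>n\<ge>m. \<forall>z\<in>insert x F. q (D n z) < e"
  using assms
proof (induction F arbitrary: x e m)
  case empty
  then have "0 < e / M" using M_ge_1 by simp
  then obtain n where n: "m \<le> n" "norm ((T ^^ n) x - S x) < e / M"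
    using orbit_limit by blast
  have "q (D n x) \<le> M * norm ((T ^^ n) x - S x)" by (simp add: D_def q_le_norm)
  also have "\<dots> < e" using n(2) M_ge_1 by (simp add: field_simps)
  finally show ?case using n(1) by auto
next
  case (insert y F)
  obtain N :: nat and \<delta> :: real where "0 < \<delta>" and
    pencil: "\<forall>r. (\<forall>i<N. q (D (r i) (x + real i *\<^sub>R y)) \<le> \<delta>) \<longrightarrow>
      (\<exists>i<N. q (D (r i) x) < e \<and> q (D (r i) y) < e)"
    using pencil_small[OF \<open>0 < e\<close>, of x y] by blast
  then have "\<forall>i. \<exists>n\<ge>m. \<forall>z\<in>insert (x + real i *\<^sub>R y) F. q (D n z) < min \<delta> e"
    using insert.IH[of "min \<delta> e"] insert.prems by simp
  then obtain r where r: "\<And>i. m \<le> r i"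
    "\<And>i z. z \<in> insert (x + real i *\<^sub>R y) F \<Longrightarrow> q (D (r i) z) < min \<delta> e"
    by metis
  then obtain i where "q (D (r i) x) < e" "q (D (r i) y) < e"
    using spec[OF pencil, of r] by (force intro: less_imp_le)
  then show ?case using r(1)[of i] r(2)[of _ i] by (intro exI[of _ "r i"]) auto
qed

text \<open>Some power of \<open>T\<close> nearly inverts \<open>S\<close> at \<open>x\<close>. For
  \<open>k = n' - 2 n\<close>, the vector \<open>T ^^ (2 n)\<close> of \<open>(T ^^ k) (S x)\<close>
  is \<open>(T ^^ n') (S x)\<close>, close to \<open>S (S x)\<close> and hence to
  \<open>(T ^^ (2 n)) x\<close>; the isometry \<open>T ^^ (2 n)\<close> cancels.\<close>

lemma S_pow_approx:
  assumes "0 < e"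
  shows "\<exists>k. q ((T ^^ k) (S x) - x) < e"
proof -
  have D_small: "\<exists>n\<ge>m. q (D n x) < e / 3" for m
    using D_simultaneously_small[of "{}" "e / 3" m x] assms by auto
  obtain n where n: "q (D n x) < e / 3" using D_small by blast
  obtain n' where n': "2 * n \<le> n'" "q (D n' x) < e / 3" using D_small by blast
  have "(T ^^ (n + n)) ((T ^^ (n' - 2 * n)) (S x)) = (T ^^ n') (S x)"
    using n'(1) by (simp flip: funpow_add[THEN fun_cong, unfolded o_apply])
  then have "(T ^^ (n + n)) ((T ^^ (n' - 2 * n)) (S x) - x) = S (D n' x) - (T ^^ n) (D n x) - S (D n x)"
    by (simp add: D_def pow_diff S_diff funpow_add commute_funpow)
  then have "q ((T ^^ (n' - 2 * n)) (S x) - x) = q (S (D n' x) - (T ^^ n) (D n x) - S (D n x))"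
    by (metis q_funpow)
  also have "\<dots> < e"
    using q_diff_le[of "S (D n' x) - (T ^^ n) (D n x)" "S (D n x)"]
      q_diff_le[of "S (D n' x)" "(T ^^ n) (D n x)"] n n'(2)
    by (simp add: q_S q_funpow)
  finally show ?thesis by blast
qed

text \<open>Split \<open>x\<close> into \<open>(T ^^ k x) (S x)\<close> and a remainder
  \<open>w x\<close> with small \<open>q\<close>. Late powers are small in norm on
  \<open>w x\<close>, and on the first part the error is \<open>S ?v\<close>, where
  \<open>norm_S_le\<close> needs only that \<open>q ?v\<close> is small.\<close>

lemma simultaneous_orbit_limit:
  assumes "finite F" "0 < e"
  shows "\<exists>n. \<forall>x\<in>F. norm ((T ^^ n) x - S x) < e"
proof -
  define d where "d = e / (3 * M + 2)"
  have "0 < d" "(3 * M + 2) * d = e" using assms(2) M_ge_1 by (simp_all add: d_def)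
  then have d: "0 < d" "3 * (M * d) + 2 * d = e" by (simp_all add: algebra_simps)
  obtain k where k: "\<And>x. q ((T ^^ k x) (S x) - x) < d"
    using S_pow_approx[OF d(1)] by metis
  define w where "w x = x - (T ^^ k x) (S x)" for x
  have w: "q (w x) < d" for x
    using k[of x] by (simp add: w_def q_commute)
  have "\<forall>x. \<exists>m. \<forall>n\<ge>m. norm ((T ^^ n) (w x)) \<le> M * q (w x) + d"
    using norm_pow_eventually_le[OF d(1)] by blast
  then obtain l where l: "\<And>x n. l x \<le> n \<Longrightarrow> norm ((T ^^ n) (w x)) \<le> M * q (w x) + d"
    by metis
  \<comment> \<open>The vectors to approximate are \<open>(T ^^ k x) x\<close>, because
    \<open>?v\<close> involves these; the inserted 0 covers an empty \<open>F\<close>.\<close>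
  obtain n where n: "Max (insert 0 (l ` F)) \<le> n"
    "\<And>z. z \<in> (\<lambda>x. (T ^^ k x) x) ` F \<Longrightarrow> q (D n z) < d"
    using D_simultaneously_small[of "(\<lambda>x. (T ^^ k x) x) ` F" d "Max (insert 0 (l ` F))" 0] assms(1) d(1)
    by auto
  show ?thesis
  proof (intro exI ballI)
    fix x assume "x \<in> F"
    then have "l x \<le> n" using n(1) assms(1) by simp
    from l[OF this] w[of x] have 1: "norm ((T ^^ n) (w x)) \<le> M * d + d"
      using M_ge_1 by (meson add_mono less_imp_le mult_left_mono order_refl order_trans zero_le_one)
    let ?v = "(T ^^ n) ((T ^^ k x) x) - x"
    have "?v = D n ((T ^^ k x) x) + ((T ^^ k x) (S x) - x)"
      by (simp add: D_def commute_funpow)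
    then have "q ?v = q (D n ((T ^^ k x) x) + ((T ^^ k x) (S x) - x))"
      by (rule arg_cong)
    also have "\<dots> \<le> q (D n ((T ^^ k x) x)) + q ((T ^^ k x) (S x) - x)"
      by (rule q_triangle)
    also have "\<dots> < d + d" using n(2) \<open>x \<in> F\<close> k by (intro add_strict_mono) auto
    finally have "norm (S ?v) \<le> M * (d + d)"
      using norm_S_le[of ?v] M_ge_1 by (meson less_imp_le mult_left_mono order_trans zero_le_one)
    moreover have "(T ^^ n) x - S x = (T ^^ n) (w x) + S ?v"
      by (simp add: w_def pow_diff S_diff commute_funpow)
    ultimately have "norm ((T ^^ n) x - S x) \<le> M * d + d + M * (d + d)"
      using norm_triangle_ineq[of "(T ^^ n) (w x)" "S ?v"] 1 by simp
    also have "\<dots> < e" using d by (simp add: algebra_simps)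
    finally show "norm ((T ^^ n) x - S x) < e" .
  qed
qed

end

section \<open>Orbit reflexivity of power bounded operators\<close>

lemma interior_kernel_empty:
  fixes A :: "'a::real_normed_vector \<Rightarrow> 'b::real_vector"
  assumes A: "linear A" and "A y \<noteq> 0"
  shows "interior {x. A x = 0} = {}"
proof (rule ccontr)
  assume "interior {x. A x = 0} \<noteq> {}"
  then obtain x e where e: "0 < e" "ball x e \<subseteq> {x. A x = 0}"
    unfolding mem_interior using equals0I by (metis mem_interior)
  have y: "y \<noteq> 0" using assms(2) linear_0[OF A] by auto
  define t where "t = e / (2 * norm y)"
  have t: "0 < t" using e y by (simp add: t_def)
  have "x + t *\<^sub>R y \<in> ball x e" using e(1) y by (simp add: dist_norm t_def)
  moreover have "x \<in> ball x e" using e(1) by simp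
  ultimately have "A (x + t *\<^sub>R y) = 0" "A x = 0" using e(2) by blast+
  then show False using assms(2) t by (simp add: linear_add[OF A] linear_cmul[OF A])
qed

text \<open>A finite initial segment together with 0 is closed, so a limit point outside it is a
  limit of the tail.\<close>

lemma closure_insert_range_limit:
  fixes f :: "nat \<Rightarrow> 'a::real_normed_vector"
  assumes y: "y \<in> closure (insert 0 (range f))" and "y \<noteq> 0" "y \<notin> range f" "0 < e"
  shows "\<exists>n\<ge>m. norm (f n - y) < e"
proof -
  let ?A = "insert 0 (f ` {..<m})"
  have "insert 0 (range f) = ?A \<union> f ` {m..}"
    by (auto simp: not_less) (metis UNIV_I atLeast_iff image_eqI lessThan_iff not_less)
  moreover have "closure ?A = ?A" by (intro closure_closed finite_imp_closed) simp
  ultimately have "y \<in> closure (f ` {m..})"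
    using y assms(2,3) by (simp only: closure_Un) auto
  then show ?thesis
    using \<open>0 < e\<close> by (auto simp: closure_approachable dist_norm)
qed

text \<open>Outside the first two cases, \<open>S\<close> and all \<open>S - T ^^ n\<close> have
  closed kernels with empty interior. Off their union, which has dense complement,
  \<open>S x\<close> is a limit of late powers; the uniform bound on powers extends this to every
  \<open>x\<close>.\<close>

lemma pointwise_orbit_limit_cases:
  fixes T S :: "'a::{real_normed_vector,complete_space} \<Rightarrow> 'a"
  assumes T: "bounded_linear T" and S: "bounded_linear S"
    and bound: "\<And>n x. norm ((T ^^ n) x) \<le> M * norm x"
    and closure: "\<And>x. S x \<in> closure (insert 0 (range (\<lambda>n. (T ^^ n) x)))"
  obtains "S = (\<lambda>_. 0)" | n where "S = T ^^ n"
    | "\<And>x e m. 0 < e \<Longrightarrow> \<exists>n\<ge>m. norm ((T ^^ n) x - S x) < e"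
proof -
  have pow: "bounded_linear (T ^^ n)" for n
  proof (rule bounded_linear_intro[where K = M])
    show "norm ((T ^^ n) x) \<le> norm x * M" for x using bound[of n x] by (simp add: mult.commute)
  qed (simp_all add: linear_add[OF linear_funpow] linear_cmul[OF linear_funpow] bounded_linear.linear[OF T])
  define \<G> where "\<G> = insert {x. S x = 0} (range (\<lambda>n. {x. S x - (T ^^ n) x = 0}))"
  show ?thesis
  proof (cases "S = (\<lambda>_. 0) \<or> (\<exists>n. S = T ^^ n)")
    case True
    then show ?thesis using that(1,2) by blast
  next
    case False
    have empty: "interior G = {}" and closed: "closed G" if "G \<in> \<G>" for G
    proof -
      from that obtain A :: "'a \<Rightarrow> 'a" where A: "bounded_linear A" "A \<noteq> (\<lambda>_. 0)" "G = {x. A x = 0}"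
      proof (cases "G = {x. S x = 0}")
        case True
        then show ?thesis using that(1)[OF S] False by blast
      next
        case neq: False
        then obtain n where "G = {x. S x - (T ^^ n) x = 0}" using \<open>G \<in> \<G>\<close> by (auto simp: \<G>_def)
        moreover have "(\<lambda>x. S x - (T ^^ n) x) \<noteq> (\<lambda>_. 0)"
          using False by (auto simp: fun_eq_iff)
        ultimately show ?thesis using that(1)[OF bounded_linear_sub[OF S pow]] by blast
      qed
      then obtain y where "A y \<noteq> 0" by auto
      then show "interior G = {}"
        unfolding A(3) by (rule interior_kernel_empty[OF bounded_linear.linear[OF A(1)]])
      show "closed G"
        unfolding A(3) by (intro closed_Collect_eq continuous_on_const linear_continuous_on A(1))
    qed
    have "euclidean interior_of \<Union>\<G> = {}"
    proof (rule Baire_category_alt)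
      show "countable \<G>" by (simp add: \<G>_def)
    qed (use empty closed completely_metrizable_space_euclidean in auto)
    then have dense: "closure (- \<Union>\<G>) = UNIV"
      by (simp add: closure_complement)
    show ?thesis
    proof (rule that(3))
      fix x :: 'a and e :: real and m :: nat assume "0 < e"
      obtain K where K: "0 < K" "\<And>x. norm (S x) \<le> norm x * K"
        using bounded_linear.pos_bounded[OF S] by blast
      \<comment> \<open>Replacing \<open>x\<close> by a point within \<open>d\<close> changes the
        error of \<open>T ^^ n - S\<close> by at most \<open>e / 2\<close>, uniformly in
        \<open>n\<close>.\<close>
      define d where "d = e / (2 * (\<bar>M\<bar> + K))"
      have d: "0 < d" using \<open>0 < e\<close> K(1) by (simp add: d_def add_nonneg_pos)
      have d_eq: "(\<bar>M\<bar> + K) * d = e / 2"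
        using K(1) abs_ge_zero[of M] by (simp add: d_def field_simps)
      obtain y where y: "y \<notin> \<Union>\<G>" "dist y x < d"
        using dense d closure_approachable[of x "- \<Union>\<G>"] by auto
      have "S y \<noteq> 0" "S y \<notin> range (\<lambda>n. (T ^^ n) y)"
        using y(1) by (auto simp: \<G>_def)
      then obtain n where n: "m \<le> n" "norm ((T ^^ n) y - S y) < e / 2"
        using closure_insert_range_limit[OF closure, of y "e / 2" m] \<open>0 < e\<close> by auto
      have "(T ^^ n) x - S x = (T ^^ n) (x - y) - S (x - y) + ((T ^^ n) y - S y)"
        by (simp add: linear_diff[OF bounded_linear.linear[OF pow]] linear_diff[OF bounded_linear.linear[OF S]])
      then have "norm ((T ^^ n) x - S x) \<le>
          norm ((T ^^ n) (x - y)) + norm (S (x - y)) + norm ((T ^^ n) y - S y)"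
        by (metis add_right_mono norm_triangle_ineq norm_triangle_ineq4 order_trans)
      also have "norm ((T ^^ n) (x - y)) \<le> \<bar>M\<bar> * norm (x - y)"
        using bound[of n "x - y"] abs_ge_self[of M] by (meson mult_right_mono norm_ge_zero order_trans)
      also have "norm (S (x - y)) \<le> K * norm (x - y)" using K(2) by (simp add: mult.commute)
      also have "\<bar>M\<bar> * norm (x - y) + K * norm (x - y) + norm ((T ^^ n) y - S y) < e / 2 + e / 2"
      proof (rule add_le_less_mono[OF _ n(2)])
        have "(\<bar>M\<bar> + K) * norm (x - y) \<le> (\<bar>M\<bar> + K) * d"
          using y(2) K(1) by (intro mult_left_mono) (auto simp: dist_norm norm_minus_commute)
        then show "\<bar>M\<bar> * norm (x - y) + K * norm (x - y) \<le> e / 2"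
          unfolding d_eq by (simp only: distrib_right)
      qed
      finally show "\<exists>n\<ge>m. norm ((T ^^ n) x - S x) < e" using n(1) by auto
    qed
  qed
qed

section \<open>Power bounds and strong operator closures\<close>

lemma blinfun_apply_op_power: "blinfun_apply (op_power T n) x = (blinfun_apply T ^^ n) x"
  by (induction n) (simp_all add: op_power_def)

lemma op_poly_monom: "op_poly (monom 1 n) T = op_power T n"
proof -
  have "op_scaleC 0 A = 0" "op_scaleC 1 A = A" for A :: "'a \<Rightarrow>\<^sub>L 'a"
    using scaleC_of_real[of 0] by (auto intro!: blinfun_eqI simp: op_scaleC.rep_eq)
  then have "(\<Sum>i\<le>n. op_scaleC (coeff (monom 1 n) i) (op_power T i)) =
      (\<Sum>i\<le>n. if i = n then op_power T i else 0)"
    by (intro sum.cong) auto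
  then show ?thesis by (simp add: op_poly_def degree_monom_eq)
qed

text \<open>Monomials have supremum 1 on the closed disc. \<open>1 \<le> M\<close> is arranged by
  \<open>max 1 K\<close>, since later estimates divide by \<open>M\<close>.\<close>

lemma polynomially_bounded_power_bounded:
  assumes "polynomially_bounded T"
  obtains M where "1 \<le> M" "\<And>n x. norm ((blinfun_apply T ^^ n) x) \<le> M * norm x"
proof -
  obtain K where K: "\<And>p. norm (op_poly p T) \<le> K * (SUP z\<in>{z. cmod z \<le> 1}. cmod (poly p z))"
    using assms unfolding polynomially_bounded_def by blast
  have sup: "(SUP z\<in>{z. cmod z \<le> 1}. cmod (poly (monom 1 n) z)) = 1" for n
    by (rule cSup_eq_maximum)
      (auto simp: poly_monom norm_power intro: power_le_one image_eqI[of _ _ 1])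
  have "norm (op_power T n) \<le> K" for n
    using K[of "monom 1 n"] by (simp add: op_poly_monom sup)
  then have "norm ((blinfun_apply T ^^ n) x) \<le> max 1 K * norm x" for n x
    using norm_blinfun[of "op_power T n" x]
    by (simp add: blinfun_apply_op_power) (meson max.coboundedI2 mult_right_mono norm_ge_zero order_trans)
  then show ?thesis using that[of "max 1 K"] by simp
qed

text \<open>The topology is pulled back from a product, so each neighbourhood contains a box that
  constrains only finitely many vectors.\<close>

lemma strong_operator_topology_closureI:
  fixes S :: "'a::real_normed_vector \<Rightarrow>\<^sub>L 'b::real_normed_vector"
  assumes "\<And>F e. finite F \<Longrightarrow> 0 < e \<Longrightarrow> \<exists>A\<in>\<A>. \<forall>x\<in>F. norm (blinfun_apply A x - blinfun_apply S x) < e"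
  shows "S \<in> strong_operator_topology closure_of \<A>"
  unfolding in_closure_of
proof (intro conjI allI impI)
  show "S \<in> topspace strong_operator_topology" by (simp add: strong_operator_topology_topspace)
  fix U assume "S \<in> U \<and> openin strong_operator_topology U"
  then obtain V where V: "open V" "U = blinfun_apply -` V" "blinfun_apply S \<in> V"
    by (auto simp: strong_operator_topology_def openin_pullback_topology)
  from product_topology_open_contains_basis[of "\<lambda>_. euclidean" UNIV V "blinfun_apply S"] V(1,3)
  obtain X where X: "blinfun_apply S \<in> Pi\<^sub>E UNIV X" "\<And>x. open (X x)" "finite {x. X x \<noteq> UNIV}"
    "Pi\<^sub>E UNIV X \<subseteq> V"
    by (auto simp: euclidean_product_topology)
  let ?F = "{x. X x \<noteq> UNIV}"
  have "\<forall>x. \<exists>e>0. ball (blinfun_apply S x) e \<subseteq> X x"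
    using X(1,2) by (auto simp: PiE_iff open_contains_ball)
  then obtain r where r: "\<And>x. 0 < r x" "\<And>x. ball (blinfun_apply S x) (r x) \<subseteq> X x" by metis
  \<comment> \<open>The inserted 1 covers the case of no constrained vector.\<close>
  define e where "e = Min (insert 1 (r ` ?F))"
  have "0 < e" using X(3) r(1) by (simp add: e_def)
  then obtain A where A: "A \<in> \<A>" "\<And>x. x \<in> ?F \<Longrightarrow> norm (blinfun_apply A x - blinfun_apply S x) < e"
    using assms[OF X(3)] by blast
  have "blinfun_apply A x \<in> X x" for x
  proof (cases "x \<in> ?F")
    case True
    then have "e \<le> r x" using X(3) by (simp add: e_def)
    then have "blinfun_apply A x \<in> ball (blinfun_apply S x) (r x)"
      using A(2)[OF True] by (simp add: dist_norm norm_minus_commute)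
    then show ?thesis using r(2) by blast
  qed simp
  then have "blinfun_apply A \<in> Pi\<^sub>E UNIV X" by (simp add: PiE_iff)
  then show "\<exists>y. y \<in> \<A> \<and> y \<in> U" using A(1) X(4) V(2) by blast
qed

lemma subset_strong_closure: "\<A> \<subseteq> strong_operator_topology closure_of \<A>"
  by (simp add: closure_of_subset strong_operator_topology_topspace)

lemma sot_closure_of:
  assumes "\<A> \<subseteq> bounded_ops"
  shows "sot closure_of \<A> = bounded_ops \<inter> (strong_operator_topology closure_of \<A>)"
  using assms by (simp add: sot_def closure_of_subtopology Int_absorb1)

text \<open>Evaluation at \<open>x\<close> is continuous; this gives the easy inclusion in both
  kinds of reflexivity.\<close>

lemma closure_of_apply_mem_closure:
  assumes "S \<in> strong_operator_topology closure_of \<A>"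
  shows "blinfun_apply S x \<in> closure (ops_at \<A> x)"
  using continuous_map_image_closure_subset[OF strong_operator_topology_continuous_evaluation[of x], of \<A>] assms
  by (auto simp: ops_at_def)

lemma ops_at_Orb: "ops_at (Orb T) x = range (\<lambda>n. (blinfun_apply T ^^ n) x)"
  by (auto simp: ops_at_def Orb_def blinfun_apply_op_power image_image)

lemma ops_at_nullOrb: "ops_at (nullOrb T) x = insert 0 (range (\<lambda>n. (blinfun_apply T ^^ n) x))"
  using ops_at_Orb[of T x] by (simp add: ops_at_def nullOrb_def)

lemma inner_scaleC_ii: "inner (\<i> *\<^sub>C x) (\<i> *\<^sub>C y) = inner x (y :: 'a::complex_inner_space)"
  by (simp add: inner_eq_Re_cinner cinner_scaleC_left cinner_scaleC_right)

text \<open>Common core of both halves of the theorem. The case \<open>S = 0\<close> stays separate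
  because 0 lies in \<open>nullOrb T\<close> by definition, but reaching it from
  \<open>Orb T\<close> takes another argument.\<close>

lemma nullOrbRef_cases:
  fixes T :: "'a::complex_hilbert_space \<Rightarrow>\<^sub>L 'a"
  assumes T: "T \<in> bounded_ops" and M: "1 \<le> M" "\<And>n x. norm ((blinfun_apply T ^^ n) x) \<le> M * norm x"
    and S: "S \<in> nullOrbRef T"
  shows "S = 0 \<or> S \<in> strong_operator_topology closure_of Orb T"
proof -
  let ?T = "blinfun_apply T" and ?S = "blinfun_apply S"
  have Sb: "S \<in> bounded_ops" and cl: "\<And>x. ?S x \<in> closure (insert 0 (range (\<lambda>n. (?T ^^ n) x)))"
    using S by (auto simp: nullOrbRef_def ops_at_nullOrb)
  show ?thesis
  proof (rule pointwise_orbit_limit_cases[OF blinfun.bounded_linear_right blinfun.bounded_linear_right M(2) cl])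
    assume "?S = (\<lambda>_. 0)"
    then show ?thesis by (simp add: blinfun_eqI)
  next
    fix n assume "?S = ?T ^^ n"
    then have "S = op_power T n" by (simp add: blinfun_eqI blinfun_apply_op_power)
    then have "S \<in> Orb T" by (simp add: Orb_def)
    then show ?thesis
      using subset_strong_closure by blast
  next
    assume lim: "\<And>x e m. 0 < e \<Longrightarrow> \<exists>n\<ge>m. norm ((?T ^^ n) x - ?S x) < e"
    obtain \<beta> where \<beta>: "semi_inner \<beta>" "\<And>x y. \<beta> (?T x) (?T y) = \<beta> x y"
      "\<And>x. \<beta> x x \<le> (M * norm x)\<^sup>2"
      "\<And>x c. 0 \<le> c \<Longrightarrow> (\<And>n. c \<le> norm ((?T ^^ n) x)) \<Longrightarrow> c\<^sup>2 \<le> \<beta> x x"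
      "\<And>J x y. (\<And>x y. inner (J x) (J y) = inner x y) \<Longrightarrow> (\<And>x. ?T (J x) = J (?T x)) \<Longrightarrow>
        \<beta> (J x) (J y) = \<beta> x y"
      using invariant_form_exists[OF bounded_linear.linear[OF blinfun.bounded_linear_right] M(2)] by blast
    have scaleC: "?T (c *\<^sub>C x) = c *\<^sub>C ?T x" "?S (c *\<^sub>C x) = c *\<^sub>C ?S x" for c x
      using T Sb by (auto simp: bounded_ops_def)
    \<comment> \<open>The assumption on \<open>\<i>\<close> is the clause of \<open>\<beta>\<close>
      on \<open>J\<close>, with \<open>J\<close> multiplication by \<open>\<i>\<close>.\<close>
    interpret orbit_limit \<beta> ?T ?S M
      by (intro orbit_limit.intro orbit_limit_axioms.intro \<beta> lim scaleC M inner_scaleC_ii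
          blinfun.bounded_linear_right)
    show ?thesis
    proof (rule disjI2, rule strong_operator_topology_closureI)
      fix F :: "'a set" and e :: real assume "finite F" "0 < e"
      then obtain n where "\<forall>x\<in>F. norm ((?T ^^ n) x - ?S x) < e"
        using simultaneous_orbit_limit by blast
      then show "\<exists>A\<in>Orb T. \<forall>x\<in>F. norm (blinfun_apply A x - ?S x) < e"
        by (auto simp: Orb_def blinfun_apply_op_power)
    qed
  qed
qed

theorem theorem21:
  fixes T :: "'a::complex_hilbert_space \<Rightarrow>\<^sub>L 'a"
  assumes "T \<in> bounded_ops"
    and "polynomially_bounded T"
  shows "null_orbit_reflexive T \<and> orbit_reflexive T"
proof -
  obtain M where M: "1 \<le> M" "\<And>n x. norm ((blinfun_apply T ^^ n) x) \<le> M * norm x"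
    using polynomially_bounded_power_bounded[OF assms(2)] by blast
  have null_sub: "nullOrb T \<subseteq> bounded_ops" by (rule nullOrb_subset_bounded_ops[OF assms(1)])
  then have sub: "Orb T \<subseteq> bounded_ops" by (auto simp: nullOrb_def)
  have "nullOrbRef T \<subseteq> strong_operator_topology closure_of nullOrb T"
  proof
    fix S assume "S \<in> nullOrbRef T"
    from nullOrbRef_cases[OF assms(1) M this]
    show "S \<in> strong_operator_topology closure_of nullOrb T"
    proof
      assume "S = 0"
      then have "S \<in> nullOrb T" by (simp add: nullOrb_def)
      then show ?thesis
        using subset_strong_closure by blast
    next
      assume "S \<in> strong_operator_topology closure_of Orb T"
      then show ?thesis
        using closure_of_mono[of "Orb T" "nullOrb T"] by (auto simp: nullOrb_def)
    qed
  qed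
  then have 1: "nullOrbRef T = sot closure_of nullOrb T"
    using closure_of_apply_mem_closure by (auto simp: sot_closure_of[OF null_sub] nullOrbRef_def)
  have "OrbRef T \<subseteq> strong_operator_topology closure_of Orb T"
  proof
    fix S assume S: "S \<in> OrbRef T"
    then have "S \<in> nullOrbRef T"
      using closure_mono[of "ops_at (Orb T) x" "ops_at (nullOrb T) x" for x]
      by (auto simp: OrbRef_def nullOrbRef_def ops_at_Orb ops_at_nullOrb)
    from nullOrbRef_cases[OF assms(1) M this]
    show "S \<in> strong_operator_topology closure_of Orb T"
    proof
      assume "S = 0"
      \<comment> \<open>As 0 is in the closure of each orbit, some power is small at
        \<open>x\<close>; the power bound keeps all later powers small, so finitely many vectors
        share an exponent.\<close>
      have small: "\<exists>m. \<forall>n\<ge>m. norm ((blinfun_apply T ^^ n) x) < e" if "0 < e" for x e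
      proof -
        have "0 < e / M" using that M by simp
        moreover have "0 \<in> closure (range (\<lambda>n. (blinfun_apply T ^^ n) x))"
          using S \<open>S = 0\<close> by (simp add: OrbRef_def ops_at_Orb)
        ultimately obtain m where m: "norm ((blinfun_apply T ^^ m) x) < e / M"
          by (auto simp: closure_approachable dist_norm)
        have "norm ((blinfun_apply T ^^ n) x) < e" if "m \<le> n" for n
        proof -
          have "(blinfun_apply T ^^ n) x = (blinfun_apply T ^^ (n - m)) ((blinfun_apply T ^^ m) x)"
            using that by (metis comp_apply funpow_add le_add_diff_inverse2)
          then have "norm ((blinfun_apply T ^^ n) x) \<le> M * norm ((blinfun_apply T ^^ m) x)"
            using M(2) by simp
          also have "\<dots> < e" using m M(1) by (simp add: field_simps)
          finally show ?thesis .
        qed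
        then show ?thesis by blast
      qed
      show ?thesis
      proof (rule strong_operator_topology_closureI)
        fix F :: "'a set" and e :: real assume "finite F" "0 < e"
        then obtain m where m: "\<And>x n. m x \<le> n \<Longrightarrow> norm ((blinfun_apply T ^^ n) x) < e"
          using small by metis
        have "\<forall>x\<in>F. norm ((blinfun_apply T ^^ Max (insert 0 (m ` F))) x) < e"
          using \<open>finite F\<close> by (auto intro!: m)
        then show "\<exists>A\<in>Orb T. \<forall>x\<in>F. norm (blinfun_apply A x - blinfun_apply S x) < e"
          using \<open>S = 0\<close> by (auto simp: Orb_def blinfun_apply_op_power)
      qed
    qed
  qed
  then have 2: "OrbRef T = sot closure_of Orb T"
    using closure_of_apply_mem_closure by (auto simp: sot_closure_of[OF sub] OrbRef_def)
  show ?thesis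
    using 1 2 by (simp add: null_orbit_reflexive_def orbit_reflexive_def)
qed

end
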